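(* Let $n,k,m\ge 1$ and $r\ge 0$ be integers with $r<m$ and $k\le\min\{n,m-r\}$. Then $$(r+1)n\le N(n,k,m;r)\le (r+k)n.$$
   Context: For a nonnegative integer $s$, $[s]=\{1,\dots,s\}$. An $r\text{-ECBC}(n,k,m)$ (erasure combinatorial batch code with redundancy $r$, with at most one item read from each server) is a multifamily $\mathcal{B}=\{B_1,\dots,B_m\}$ of $m$ subsets of $[n]$ such that for each $Y\subseteq[n]$ with $|Y|\le k$ and each $J\subseteq[m]$ with $|J|\ge m-r$ there exist subsets $C_j\subseteq B_j$ ($j\in J$) with $|C_j|\le 1$ and $Y=\bigcup_{j\in J}C_j$. Its weight is $N(\mathcal{B})=|B_1|+\cdots+|B_m|$. $N(n,k,m;r)$ denotes the minimum weight of an $r\text{-ECBC}(n,k,m)$. *)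

theory Defs
  imports Main
begin

text \<open>A multifamily of \<open>m\<close> subsets of \<open>{1..n}\<close> is an indexed family \<open>B\<close>, of which only
  the values \<open>B 1, \<dots>, B m\<close> matter. The truncated subtraction \<open>m - r\<close> is harmless: for
  \<open>r \<ge> m\<close> the bound on \<open>card J\<close> is vacuous either way.\<close>

definition is_ECBC :: "nat \<Rightarrow> nat \<Rightarrow> nat \<Rightarrow> nat \<Rightarrow> (nat \<Rightarrow> nat set) \<Rightarrow> bool" where
  "is_ECBC r n k m B \<longleftrightarrow>
     (\<forall>j\<in>{1..m}. B j \<subseteq> {1..n}) \<and>
     (\<forall>Y J. Y \<subseteq> {1..n} \<and> card Y \<le> k \<and> J \<subseteq> {1..m} \<and> card J \<ge> m - r \<longrightarrow>
        (\<exists>C. (\<forall>j\<in>J. C j \<subseteq> B j \<and> card (C j) \<le> 1) \<and> Y = (\<Union>j\<in>J. C j)))"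

definition weight :: "nat \<Rightarrow> (nat \<Rightarrow> nat set) \<Rightarrow> nat" where
  "weight m B = (\<Sum>j\<in>{1..m}. card (B j))"

definition min_weight :: "nat \<Rightarrow> nat \<Rightarrow> nat \<Rightarrow> nat \<Rightarrow> nat" where
  "min_weight n k m r = (LEAST w. \<exists>B. is_ECBC r n k m B \<and> weight m B = w)"

text \<open>If \<open>k \<le> m - r\<close>, then an ECBC exists, so \<open>min_weight\<close> is an attained minimum.\<close>

lemma is_ECBC_full:
  assumes "k \<le> m - r"
  shows "is_ECBC r n k m (\<lambda>_. {1..n})"
  unfolding is_ECBC_def
proof (intro conjI allI impI)
  fix Y J :: "nat set"
  assume A: "Y \<subseteq> {1..n} \<and> card Y \<le> k \<and> J \<subseteq> {1..m} \<and> card J \<ge> m - r"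
  then have fin: "finite Y" "finite J"
    by (auto intro: finite_subset)
  have "card Y \<le> card J"
    using A assms by linarith
  then obtain f where f: "f ` Y \<subseteq> J" "inj_on f Y"
    using card_le_inj[OF fin] by metis
  define C where "C j = {y \<in> Y. f y = j}" for j
  have "card (C j) \<le> 1" for j
    unfolding C_def using f(2) fin(1)
    by (auto simp: card_le_Suc0_iff_eq inj_on_def)
  moreover have "C j \<subseteq> {1..n}" for j
    using A by (auto simp: C_def)
  moreover have "Y = (\<Union>j\<in>J. C j)"
    using f(1) by (auto simp: C_def)
  ultimately show "\<exists>C. (\<forall>j\<in>J. C j \<subseteq> {1..n} \<and> card (C j) \<le> 1) \<and> Y = (\<Union>j\<in>J. C j)"
    by (intro exI[of _ C]) simp
qed simp

lemma min_weight_attained: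
  assumes "k \<le> m - r"
  shows "\<exists>B. is_ECBC r n k m B \<and> weight m B = min_weight n k m r"
  unfolding min_weight_def
  by (rule LeastI_ex, intro exI conjI, rule is_ECBC_full[OF assms], rule refl)

lemma min_weight_le:
  assumes "is_ECBC r n k m B"
  shows "min_weight n k m r \<le> weight m B"
  unfolding min_weight_def by (rule Least_le, intro exI conjI, rule assms, rule refl)

end

theory Submission
  imports Defs
begin

text \<open>
  Lower bound: an item stored on at most \<open>r\<close> servers becomes unavailable when exactly these
  servers fail, so a code with \<open>k \<ge> 1\<close> keeps at least \<open>r + 1\<close> copies of each of the \<open>n\<close> items,
  and counting the pairs (server, item stored there) item by item bounds the weight
  (lemmas \<open>ECBC_replication\<close> and \<open>ECBC_weight_ge\<close>).

  Upper bound: fill \<open>r + k\<close> servers with all the items and leave the others empty. Any \<open>r\<close>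
  failures spare at least \<open>k\<close> of the full servers, and from these any \<open>k\<close> items can be read,
  one from each (lemma \<open>is_ECBC_concentrated\<close>).
\<close>

lemma ECBC_replication:
  assumes B: "is_ECBC r n k m B" and k: "k \<ge> 1" and x: "x \<in> {1..n}"
  shows "r + 1 \<le> card {j \<in> {1..m}. x \<in> B j}"
proof (rule ccontr)
  assume few: "\<not> r + 1 \<le> card {j \<in> {1..m}. x \<in> B j}"
  \<comment> \<open>All servers holding \<open>x\<close> fail; the request for \<open>x\<close> alone cannot be served by the rest.\<close>
  define J where "J = {1..m} - {j \<in> {1..m}. x \<in> B j}"
  have "card J = m - card {j \<in> {1..m}. x \<in> B j}"
    unfolding J_def by (subst card_Diff_subset) auto
  with few have "m - r \<le> card J"
    by linarith
  moreover have "J \<subseteq> {1..m}"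
    by (auto simp: J_def)
  ultimately obtain C
    where C: "\<forall>j\<in>J. C j \<subseteq> B j \<and> card (C j) \<le> 1" and x_eq: "{x} = (\<Union>j\<in>J. C j)"
    using B k x unfolding is_ECBC_def
    by (metis card_1_singleton_iff One_nat_def empty_subsetI insert_subset)
  from x_eq obtain j where "j \<in> J" "x \<in> C j"
    by blast
  with C show False
    by (auto simp: J_def)
qed

lemma ECBC_weight_ge:
  assumes B: "is_ECBC r n k m B" and k: "k \<ge> 1"
  shows "(r + 1) * n \<le> weight m B"
proof -
  have B_eq: "{x \<in> {1..n}. x \<in> B j} = B j" if "j \<in> {1..m}" for j
    using B that unfolding is_ECBC_def by blast
  have "(r + 1) * n = (\<Sum>x\<in>{1..n}. r + 1)"
    by simp
  also have "\<dots> \<le> (\<Sum>x\<in>{1..n}. card {j \<in> {1..m}. x \<in> B j})"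
    by (intro sum_mono ECBC_replication[OF B k])
  also have "\<dots> = (\<Sum>j\<in>{1..m}. card {x \<in> {1..n}. x \<in> B j})"
    by (rule sum_multicount_gen[symmetric]) auto
  also have "\<dots> = weight m B"
    unfolding weight_def by (intro sum.cong refl arg_cong[where f = card] B_eq)
  finally show ?thesis .
qed

text \<open>At least \<open>k\<close> members of \<open>S\<close> survive any \<open>r\<close> failures, so the items of a request can be
  assigned injectively to surviving full servers.\<close>

lemma is_ECBC_concentrated:
  assumes S: "S \<subseteq> {1..m}" and card_S: "card S = r + k"
  shows "is_ECBC r n k m (\<lambda>j. if j \<in> S then {1..n} else {})"
  unfolding is_ECBC_def
proof (intro conjI allI impI)
  fix Y J :: "nat set"
  assume A: "Y \<subseteq> {1..n} \<and> card Y \<le> k \<and> J \<subseteq> {1..m} \<and> card J \<ge> m - r"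
  have fin: "finite Y" "finite J" "finite S"
    using A S by (auto intro: finite_subset)
  have "card S + card J = card (S \<union> J) + card (S \<inter> J)"
    using fin by (intro card_Un_Int)
  moreover have "card (S \<union> J) \<le> m"
    using A S card_mono[of "{1..m}" "S \<union> J"] by simp
  ultimately have "card Y \<le> card (S \<inter> J)"
    using A card_S by linarith
  then obtain f where f: "f ` Y \<subseteq> S \<inter> J" "inj_on f Y"
    using card_le_inj[OF fin(1), of "S \<inter> J"] fin by blast
  define C where "C j = {y \<in> Y. f y = j}" for j
  have "card (C j) \<le> 1" for j
    unfolding C_def using f(2) fin(1)
    by (auto simp: card_le_Suc0_iff_eq inj_on_def)
  moreover have "C j \<subseteq> (if j \<in> S then {1..n} else {})" for j
    using A f(1) by (auto simp: C_def)
  moreover have "Y = (\<Union>j\<in>J. C j)"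
    using f(1) by (auto simp: C_def)
  ultimately show "\<exists>C. (\<forall>j\<in>J. C j \<subseteq> (if j \<in> S then {1..n} else {}) \<and> card (C j) \<le> 1) \<and>
      Y = (\<Union>j\<in>J. C j)"
    by blast
qed simp

lemma weight_concentrated:
  assumes "S \<subseteq> {1..m}"
  shows "weight m (\<lambda>j. if j \<in> S then {1..n} else {}) = card S * n"
proof -
  have "weight m (\<lambda>j. if j \<in> S then {1..n} else {}) = (\<Sum>j\<in>{1..m}. if j \<in> S then n else 0)"
    unfolding weight_def by (intro sum.cong) auto
  also have "\<dots> = card S * n"
    using assms by (simp add: sum.If_cases Int_absorb1)
  finally show ?thesis .
qed

theorem corollary7:
  fixes n k m r :: nat
  assumes "n \<ge> 1" and "k \<ge> 1" and "m \<ge> 1"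
    and "r < m"
    and "k \<le> min n (m - r)"
  shows "(r + 1) * n \<le> min_weight n k m r \<and> min_weight n k m r \<le> (r + k) * n"
proof
  from assms(5) have "k \<le> m - r"
    by simp
  then obtain B where "is_ECBC r n k m B" "weight m B = min_weight n k m r"
    using min_weight_attained by blast
  then show "(r + 1) * n \<le> min_weight n k m r"
    using ECBC_weight_ge[of r n k m B] assms(2) by simp
next
  have S: "{1..r + k} \<subseteq> {1..m}"
    using assms(4,5) by auto
  show "min_weight n k m r \<le> (r + k) * n"
    using min_weight_le[OF is_ECBC_concentrated[OF S, of r k n]] weight_concentrated[OF S, of n]
    by (metis card_atLeastAtMost diff_Suc_1)
qed

end
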